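(* Let $\langle A\rangle$ be a GCNS numerical semigroup and let $p$ be a positive divisor of $a$ with $p\neq a$. Suppose $X(a-p)=(x_1,\ldots,x_k)$ is the greedy presentation of $a-p$ (so $x_k=\lfloor \frac{a-p}{b_k}\rfloor$). If $ua+d+k-2\geq \sum_{i=1}^{k-1}s_i$, $a+pd\geq 0$, and $s_i<u+1$ for all $1\leq i\leq k-1$, then $$F\left(\frac{\langle A\rangle}{p}\right)=\sum_{i=1}^k x_i\cdot\frac{a}{p}+\left(\frac{a}{p}-1\right)(ua+d)-\frac{a}{p}.$$ In particular, if $d>0$, it suffices to assume $ua+d+k-2\geq\sum_{i=1}^{k-1}s_i$ and $s_i\leq u+1$ for $1\leq i\leq k-1$, and the formula remains valid.
   Context: A GCNS numerical semigroup is $\langle A\rangle$ with $A=(a,h_1a+db_1,\ldots,h_ka+db_k)$, where $a,k\geq 2$, $d\in\mathbb{Z}\setminus\{0\}$, $\gcd(a,d)=1$, $b_1=1$, $b_{i+1}=s_ib_i+1$ with $1\leq s_1\leq s_2\leq\cdots\leq s_{k-1}$, $h_i=ub_i+1$ with $u\in\mathbb{Z}^+$, and additionally $h_ia+db_i>1$ for all $i$ when $d<0$. For $p\in\mathbb{Z}^+$, $\frac{\langle A\rangle}{p}=\{x\in\mathbb{N}\mid px\in\langle A\rangle\}$, and $F(S)$ denotes the Frobenius number (largest integer not in $S$). The greedy presentation $X(M)=(x_1,\ldots,x_k)$ of $M\in\mathbb{N}$ is the unique solution in $\mathbb{N}^k$ of $\sum_i b_ix_i=M$ with $x_k=\lfloor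 M/b_k\rfloor$, $x_i\in\{0,1,\ldots,s_i\}$ for $1\leq i\leq k-1$, and such that if $x_i=s_i$ for some $2\leq i\leq k-1$ then $x_1=\cdots=x_{i-1}=0$. *)

theory Defs
  imports Main
begin

definition generated_semigroup :: "int set \<Rightarrow> int set" where
  "generated_semigroup A = {\<Sum>g\<in>A. int (c g) * g | c :: int \<Rightarrow> nat. True}"

definition semigroup_quotient :: "int set \<Rightarrow> nat \<Rightarrow> nat set" where
  "semigroup_quotient S p = {x. int p * int x \<in> S}"

text \<open>The largest integer (not natural number) outside \<open>S\<close>, so the value for
  \<open>S = UNIV\<close> is \<open>- 1\<close>.\<close>

definition frobenius_number :: "nat set \<Rightarrow> int" where
  "frobenius_number S = (GREATEST z :: int. z \<notin> int ` S)"

text \<open>Sequences are indexed from 1: only \<open>s 1, \<dots>, s (k - 1)\<close>, \<open>b 1, \<dots>, b k\<close> and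
  \<open>h 1, \<dots>, h k\<close> are constrained or used.\<close>

definition gcns_generators ::
    "nat \<Rightarrow> nat \<Rightarrow> int \<Rightarrow> (nat \<Rightarrow> nat) \<Rightarrow> (nat \<Rightarrow> nat) \<Rightarrow> int set" where
  "gcns_generators a k d b h =
     insert (int a) ((\<lambda>i. int (h i) * int a + d * int (b i)) ` {1..k})"

locale gcns =
  fixes a k u :: nat and d :: int and s b h :: "nat \<Rightarrow> nat"
  assumes a_ge_2: "a \<ge> 2"
    and k_ge_2: "k \<ge> 2"
    and u_pos: "u > 0"
    and d_nonzero: "d \<noteq> 0"
    and coprime_a_d: "gcd (int a) d = 1"
    and s_1_ge_1: "1 \<le> s 1"
    and s_mono: "\<And>i. \<lbrakk>1 \<le> i; i + 1 \<le> k - 1\<rbrakk> \<Longrightarrow> s i \<le> s (i + 1)"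
    and b_1: "b 1 = 1"
    and b_step: "\<And>i. \<lbrakk>1 \<le> i; i \<le> k - 1\<rbrakk> \<Longrightarrow> b (i + 1) = s i * b i + 1"
    and h_eq: "\<And>i. \<lbrakk>1 \<le> i; i \<le> k\<rbrakk> \<Longrightarrow> h i = u * b i + 1"
    and generators_gt_1:
      "\<And>i. \<lbrakk>d < 0; 1 \<le> i; i \<le> k\<rbrakk> \<Longrightarrow> int (h i) * int a + d * int (b i) > 1"

definition greedy_presentation ::
    "nat \<Rightarrow> (nat \<Rightarrow> nat) \<Rightarrow> (nat \<Rightarrow> nat) \<Rightarrow> nat \<Rightarrow> (nat \<Rightarrow> nat) \<Rightarrow> bool" where
  "greedy_presentation k s b M x \<longleftrightarrow>
     (\<Sum>i=1..k. b i * x i) = M \<and>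
     x k = M div b k \<and>
     (\<forall>i\<in>{1..k - 1}. x i \<le> s i) \<and>
     (\<forall>i\<in>{2..k - 1}. x i = s i \<longrightarrow> (\<forall>j\<in>{1..i - 1}. x j = 0))"

end

theory Submission
  imports Defs "HOL-Number_Theory.Cong"
begin

text \<open>
  Put \<open>w = u a + d\<close>. Every generator other than \<open>a\<close> is \<open>b\<^sub>i w + a\<close>, so \<open>\<langle>A\<rangle>\<close> consists of the
  numbers \<open>w M + n a\<close> with \<open>n\<close> at least the minimal number of summands \<open>b\<^sub>i\<close> needed to write \<open>M\<close>,
  and that minimum is attained by the greedy presentation because the \<open>s\<^sub>i\<close> are nondecreasing.
  Writing \<open>g(M)\<close> for the greedy number of summands and \<open>q = a / p\<close>, coprimality of \<open>w\<close> and \<open>a\<close> gives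
  \<open>\<langle>A\<rangle> / p = {w m + n q | n \<ge> g(p m)}\<close>. The bound on \<open>\<Sum> s\<^sub>i\<close> says that \<open>g(M) \<le> g(M') + w\<close> for
  \<open>M \<le> M'\<close>, so the least element of the class of \<open>w r\<close> modulo \<open>q\<close>, \<open>0 \<le> r < q\<close>, is
  \<open>w r + q g(p r)\<close>. Passing from \<open>M\<close> to \<open>M + 1\<close> lowers \<open>g\<close> by at most \<open>max s\<^sub>i - 1\<close>, so the bound
  on the \<open>s\<^sub>i\<close> makes these least elements increase with \<open>r\<close>; the last one, at \<open>r = q - 1\<close>, minus \<open>q\<close>
  is the Frobenius number.
\<close>

section \<open>Counting the summands of a greedy expansion\<close>

text \<open>The digits are successive quotients, from the largest \<open>b j\<close> down. At
  \<open>0\<close> any remainder is dropped; this loses nothing once \<open>b 1 = 1\<close>.\<close>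

primrec greedy_count :: "(nat \<Rightarrow> nat) \<Rightarrow> nat \<Rightarrow> nat \<Rightarrow> nat" where
  "greedy_count b 0 M = 0"
| "greedy_count b (Suc j) M = M div b (Suc j) + greedy_count b j (M mod b (Suc j))"

lemma greedy_count_0 [simp]: "greedy_count b j 0 = 0"
  by (induction j) auto

lemma greedy_count_add_mult:
  assumes "b (Suc j) > 0"
  shows "greedy_count b (Suc j) (t * b (Suc j) + M) = t + greedy_count b (Suc j) M"
  using assms by simp

lemma greedy_count_less:
  "M < b (Suc j) \<Longrightarrow> greedy_count b (Suc j) M = greedy_count b j M"
  by simp

lemma greedy_count_attained:
  assumes "b 1 = 1" and "1 \<le> j"
  shows "\<exists>y. (\<Sum>i=1..j. b i * y i) = M \<and> (\<Sum>i=1..j. y i) = greedy_count b j M"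
  using \<open>1 \<le> j\<close>
proof (induction j arbitrary: M rule: dec_induct)
  case base
  show ?case using assms(1) by (intro exI[of _ "\<lambda>_. M"]) simp
next
  case (step j)
  obtain y where y: "(\<Sum>i=1..j. b i * y i) = M mod b (Suc j)"
    "(\<Sum>i=1..j. y i) = greedy_count b j (M mod b (Suc j))"
    using step.IH by blast
  let ?y = "y(Suc j := M div b (Suc j))"
  have "(\<Sum>i=1..j. b i * ?y i) = (\<Sum>i=1..j. b i * y i)" "(\<Sum>i=1..j. ?y i) = (\<Sum>i=1..j. y i)"
    by (auto intro!: sum.cong)
  then show ?case using y by (intro exI[of _ ?y]) (simp add: add.commute)
qed

context gcns
begin

section \<open>Monotonicity of the sequences\<close>

lemma s_le: "1 \<le> i \<Longrightarrow> i \<le> j \<Longrightarrow> j < k \<Longrightarrow> s i \<le> s j"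
proof (induction j)
  case (Suc j)
  then show ?case using s_mono[of j] by (cases "i = Suc j") fastforce+
qed simp

lemma s_pos: "1 \<le> i \<Longrightarrow> i < k \<Longrightarrow> 1 \<le> s i"
  using s_le[of 1 i] s_1_ge_1 by simp

lemma b_Suc: "1 \<le> i \<Longrightarrow> i < k \<Longrightarrow> b (Suc i) = s i * b i + 1"
  using b_step[of i] by simp

lemma b_pos: "1 \<le> i \<Longrightarrow> i \<le> k \<Longrightarrow> b i > 0"
  using b_1 b_Suc[of "i - 1"] by (cases "i = 1") auto

lemma b_less_Suc: "1 \<le> i \<Longrightarrow> i < k \<Longrightarrow> b i < b (Suc i)"
  using b_Suc[of i] s_pos[of i] by (cases "s i") auto

lemma b_less: "1 \<le> i \<Longrightarrow> i < j \<Longrightarrow> j \<le> k \<Longrightarrow> b i < b j"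
proof (induction j)
  case (Suc j)
  then show ?case using b_less_Suc[of j] by (cases "i = j") auto
qed simp

section \<open>Variation of the greedy count\<close>

lemma greedy_count_top:
  assumes "1 \<le> j" "j < k"
  shows "greedy_count b j (b (Suc j) - 1) = s j"
proof -
  obtain i where i: "j = Suc i" using assms by (cases j) auto
  have "b j > 0" using b_pos assms by simp
  then show ?thesis using b_Suc[OF assms] by (simp add: i)
qed

text \<open>Without a carry into the top digit, induction applies. With a carry, the remainder is
  \<open>b (Suc j) - 1 = s j * b j\<close>, so \<open>s j\<close> summands are replaced by a single
  one.\<close>

lemma greedy_count_le_Suc:
  assumes "1 \<le> j" "j \<le> k" "\<And>i. 1 \<le> i \<Longrightarrow> i < j \<Longrightarrow> s i \<le> c" "1 \<le> c"
  shows "greedy_count b j M + 1 \<le> greedy_count b j (M + 1) + c"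
  using assms(1-3)
proof (induction j arbitrary: M rule: dec_induct)
  case base
  show ?case using b_1 by simp
next
  case (step j)
  let ?B = "b (Suc j)"
  let ?r = "M mod ?B"
  have Bpos: "?B > 0" using b_pos step by simp
  show ?case
  proof (cases "?r + 1 < ?B")
    case True
    have "greedy_count b j ?r + 1 \<le> greedy_count b j (?r + 1) + c"
      using step by simp
    moreover have "(M + 1) mod ?B = ?r + 1" "(M + 1) div ?B = M div ?B"
      using True by (simp_all add: mod_Suc div_Suc)
    ultimately show ?thesis by simp
  next
    case False
    then have r: "?r = ?B - 1" using mod_less_divisor[OF Bpos, of M] by linarith
    then have "Suc ?r = ?B" using Bpos by simp
    then have "(M + 1) mod ?B = 0" "(M + 1) div ?B = M div ?B + 1"
      by (simp_all add: mod_Suc div_Suc)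
    moreover have "greedy_count b j ?r = s j"
      using r greedy_count_top step by simp
    moreover have "s j \<le> c" using step by simp
    ultimately show ?thesis by simp
  qed
qed

lemma greedy_count_add_le:
  assumes "1 \<le> j" "j \<le> k" "\<And>i. 1 \<le> i \<Longrightarrow> i < j \<Longrightarrow> s i \<le> c" "1 \<le> c"
  shows "greedy_count b j M + n \<le> greedy_count b j (M + n) + n * c"
proof (induction n)
  case (Suc n)
  then show ?case using greedy_count_le_Suc[OF assms, of "M + n"] by simp
qed simp

text \<open>The carry case of \<open>greedy_count_add_b\<close>: the remainder \<open>r + b\<^sub>j\<^sub>+\<^sub>1 - b\<^sub>i\<close> drops to \<open>r\<close> when \<open>b\<^sub>i\<close> is
  added. For \<open>i < j\<close> the step \<open>r \<mapsto> r + 1\<close> costs at most \<open>s\<^sub>j - 1\<close>, exactly what the quotient by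
  \<open>b\<^sub>j\<close> gains.\<close>

lemma greedy_count_le_shift:
  assumes "1 \<le> i" "i \<le> j" "j < k" "r < b i"
  shows "greedy_count b j r \<le> greedy_count b j (r + (b (Suc j) - b i))"
  using assms(2-4)
proof (induction j arbitrary: r rule: dec_induct)
  case base
  obtain j where j: "i = Suc j" using assms(1) by (cases i) auto
  have sp: "1 \<le> s i" using s_pos assms(1) base by simp
  have "r + (b (Suc i) - b i) = (s i - 1) * b i + (r + 1)"
    using b_Suc[of i] assms(1) base sp by (cases "s i") auto
  then have "greedy_count b i (r + (b (Suc i) - b i)) = (s i - 1) + greedy_count b i (r + 1)"
    using greedy_count_add_mult[of b j "s i - 1" "r + 1"] b_pos[of i] assms(1) base
    unfolding j by (metis Suc_leI less_imp_le)
  moreover have "greedy_count b i r + 1 \<le> greedy_count b i (r + 1) + s i"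
    using base assms(1) sp s_le by (intro greedy_count_le_Suc) auto
  ultimately show ?case using sp by simp
next
  case (step j)
  let ?j = "Suc j"
  have jk: "?j < k" using step by simp
  have bj: "b i < b ?j" using b_less assms(1) step by simp
  have sp: "1 \<le> s ?j" using s_pos jk by simp
  have bpos: "b ?j > 0" using bj by simp
  have eq: "r + (b (Suc ?j) - b i) = (s ?j - 1) * b ?j + (r + 1 + (b ?j - b i))"
    using b_Suc[of ?j] jk sp bj by (cases "s ?j") auto
  have "greedy_count b ?j (r + (b (Suc ?j) - b i))
      = (s ?j - 1) + greedy_count b ?j (r + 1 + (b ?j - b i))"
    unfolding eq by (rule greedy_count_add_mult[of b j "s ?j - 1", OF bpos])
  moreover have "greedy_count b ?j r + 1 \<le> greedy_count b ?j (r + 1) + s ?j"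
    using jk sp s_le by (intro greedy_count_le_Suc) auto
  moreover have "greedy_count b ?j (r + 1) \<le> greedy_count b ?j (r + 1 + (b ?j - b i))"
    if "r + 1 < b i"
  proof -
    have "greedy_count b j (r + 1) \<le> greedy_count b j (r + 1 + (b ?j - b i))"
      using step.IH[of "r + 1"] jk that by simp
    moreover have "r + 1 < b ?j" "r + 1 + (b ?j - b i) < b ?j" using that bj by simp_all
    ultimately show ?thesis by (simp only: greedy_count_less)
  qed
  \<comment> \<open>The boundary case, out of reach of the induction hypothesis: the shifted number
    is exactly \<open>b ?j\<close>, while \<open>r = b i - 1\<close> is 0 or
    \<open>s l * b l\<close> with \<open>l = i - 1\<close>, of count \<open>s l\<close>, and
    \<open>s\<close> is monotone.\<close>
  moreover have "greedy_count b ?j r \<le> s ?j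
      \<and> greedy_count b ?j (r + 1 + (b ?j - b i)) = 1" if "r + 1 = b i"
  proof -
    have "greedy_count b ?j r \<le> s ?j"
    proof (cases "i = 1")
      case True
      then show ?thesis using that b_1 by simp
    next
      case False
      then obtain l where l: "i = Suc l" "1 \<le> l" using assms(1) by (cases i) auto
      have rb: "r < b i" using that by simp
      have r: "b (Suc l) - 1 = r" using that l(1) by simp
      have lj: "l \<le> ?j" using l(1) step.hyps by simp
      then have lk: "l < k" using jk by simp
      have "greedy_count b n r = s l" if "n \<ge> l" "n \<le> ?j" for n
        using that
      proof (induction n rule: dec_induct)
        case base
        show ?case using greedy_count_top[OF l(2) lk] r by simp
      next
        case (step n)
        have "r < b (Suc n)"
          using rb l step jk b_less[of i "Suc n"] assms(1) by (cases "i = Suc n") auto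
        then show ?case using step by simp
      qed
      from this[OF lj order_refl] show ?thesis using s_le[OF l(2) lj jk] by (simp only:)
    qed
    moreover have "r + 1 + (b ?j - b i) = b ?j" using that bj by simp
    ultimately show ?thesis using bpos by simp
  qed
  ultimately show ?case using step.prems sp by linarith
qed

section \<open>Optimality of the greedy expansion\<close>

lemma greedy_count_add_b:
  assumes "1 \<le> i" "i \<le> j" "j \<le> k"
  shows "greedy_count b j (M + b i) \<le> greedy_count b j M + 1"
  using assms(2,3)
proof (induction j arbitrary: M rule: dec_induct)
  case base
  obtain j where j: "i = Suc j" using assms(1) by (cases i) auto
  show ?case
    using greedy_count_add_mult[of b j 1 M] b_pos[of i] assms(1) base by (simp add: j add.commute)
next
  case (step j)
  let ?B = "b (Suc j)"
  let ?r = "M mod ?B"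
  have bi: "b i < ?B" using b_less assms(1) step by simp
  have rB: "?r < ?B" using bi by simp
  have M: "M = M div ?B * ?B + ?r" by simp
  have *: "greedy_count b (Suc j) (M + b i) = M div ?B + greedy_count b (Suc j) (?r + b i)"
    using greedy_count_add_mult[of b j "M div ?B" "?r + b i"] bi
    by (metis M add.assoc less_zeroE not_gr_zero)
  have IH: "greedy_count b j (?r + b i) \<le> greedy_count b j ?r + 1" using step by simp
  show ?case
  proof (cases "?r + b i < ?B")
    case True
    then show ?thesis using * IH greedy_count_less[of "?r + b i" b j] by simp
  next
    case False
    \<comment> \<open>The remainder left after the carry. The carry adds one to the top digit, and
      passing from \<open>?r\<close> down to \<open>t\<close> is the shift that does not raise the
      count.\<close>
    define t where "t = ?r + b i - ?B"
    have t: "?r + b i = 1 * ?B + t" "t < b i" "?r = t + (?B - b i)"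
      unfolding t_def using False rB bi by linarith+
    have "greedy_count b (Suc j) (?r + b i) = 1 + greedy_count b (Suc j) t"
      unfolding t(1) using bi by (intro greedy_count_add_mult) simp
    also have "greedy_count b (Suc j) t = greedy_count b j t"
      using t(2) bi by (intro greedy_count_less) simp
    also have "greedy_count b j t \<le> greedy_count b j ?r"
      unfolding t(3) using assms(1) step t(2) by (intro greedy_count_le_shift) auto
    finally show ?thesis using * by simp
  qed
qed

text \<open>Build the sum from 0 one summand at a time: each \<open>b i\<close> raises the greedy
  count by at most one.\<close>

lemma greedy_count_optimal:
  "greedy_count b k (\<Sum>i=1..k. b i * y i) \<le> (\<Sum>i=1..k. y i)"
proof -
  have mult: "greedy_count b k (M + b i * n) \<le> greedy_count b k M + n" if "i \<in> {1..k}" for M i n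
  proof (induction n)
    case (Suc n)
    then show ?case using greedy_count_add_b[of i k "M + b i * n"] that by (simp add: algebra_simps)
  qed simp
  have "greedy_count b k (\<Sum>i=1..j. b i * y i) \<le> (\<Sum>i=1..j. y i)" if "j \<le> k" for j
    using that
  proof (induction j)
    case (Suc j)
    then show ?case using mult[of "Suc j" "\<Sum>i=1..j. b i * y i" "y (Suc j)"] by simp
  qed simp
  then show ?thesis by simp
qed

section \<open>Bounding the drop of the greedy count\<close>

text \<open>A top digit equal to its maximum \<open>s j\<close> forces all lower digits to vanish.
  Otherwise it is at most \<open>s j - 1\<close>, so each level above the first saves one
  unit.\<close>

lemma greedy_count_residue_bound:
  assumes "1 \<le> j" "j < k" "r < b (Suc j)"
  shows "greedy_count b j r + (j - 1) \<le> (\<Sum>i=1..j. s i)"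
  using assms
proof (induction j arbitrary: r rule: dec_induct)
  case base
  then show ?case using b_1 b_Suc[of 1] by simp
next
  case (step j)
  let ?B = "b (Suc j)"
  have Bpos: "?B > 0" using b_pos step by simp
  have sum: "j \<le> (\<Sum>i=1..j. s i)"
    using sum_mono[of "{1..j}" "\<lambda>_. 1" s] s_pos step by simp
  have r: "r \<le> s (Suc j) * ?B" using b_Suc[of "Suc j"] step by simp
  show ?case
  proof (cases "r = s (Suc j) * ?B")
    case True
    then show ?thesis using Bpos sum by simp
  next
    case False
    then have "r div ?B < s (Suc j)" using r by (simp add: less_mult_imp_div_less)
    moreover have "greedy_count b j (r mod ?B) + (j - 1) \<le> (\<Sum>i=1..j. s i)"
      using step Bpos by simp
    ultimately show ?thesis using step.hyps by simp
  qed
qed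

text \<open>The quotient by \<open>b k\<close> is monotone, so only the count of the residue modulo
  \<open>b k\<close> can fall.\<close>

lemma greedy_count_le_later:
  assumes "M \<le> M'"
  shows "greedy_count b k M + (k - 2) \<le> greedy_count b k M' + (\<Sum>i=1..k - 1. s i)"
proof -
  obtain l where l: "k = Suc l" "1 \<le> l" using k_ge_2 by (cases k) auto
  have "greedy_count b l (M mod b k) + (l - 1) \<le> (\<Sum>i=1..l. s i)"
    using l b_pos[of k] by (intro greedy_count_residue_bound) auto
  moreover have "M div b k \<le> M' div b k" using assms by (rule div_le_mono)
  ultimately show ?thesis using l by simp
qed

section \<open>Agreement with the greedy presentation\<close>

lemma greedy_presentation_sum:
  assumes "greedy_presentation k s b M x"
  shows "(\<Sum>i=1..k. x i) = greedy_count b k M"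
proof -
  have le: "x i \<le> s i" if "1 \<le> i" "i < k" for i
    using assms that by (auto simp: greedy_presentation_def)
  have full: "x j = 0" if "2 \<le> i" "i < k" "x i = s i" "1 \<le> j" "j < i" for i j
    using assms that unfolding greedy_presentation_def by force
  \<comment> \<open>Partial sums below the next \<open>b\<close> are genuine remainders, so the
    digits \<open>x i\<close> are the quotients of the recursion. A full digit \<open>s i\<close>
    stays below only because the lower digits are then 0.\<close>
  have bound: "(\<Sum>i=1..j. b i * x i) < b (Suc j)" if "1 \<le> j" "j < k" for j
    using that
  proof (induction j rule: dec_induct)
    case base
    then show ?case using b_1 b_Suc[of 1] le[of 1] by simp
  next
    case (step j)
    let ?B = "b (Suc j)"
    have B: "b (Suc (Suc j)) = s (Suc j) * ?B + 1" using b_Suc step by simp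
    show ?case
    proof (cases "x (Suc j) = s (Suc j)")
      case True
      then have "(\<Sum>i=1..j. b i * x i) = 0"
        using full[of "Suc j"] step by simp
      then show ?thesis using B True by (simp add: mult.commute)
    next
      case False
      then have "Suc (x (Suc j)) \<le> s (Suc j)" using le[of "Suc j"] step by simp
      then have "Suc (x (Suc j)) * ?B \<le> s (Suc j) * ?B" by (rule mult_le_mono1)
      then show ?thesis using B step by (simp add: mult.commute)
    qed
  qed
  have "(\<Sum>i=1..j. x i) = greedy_count b j (\<Sum>i=1..j. b i * x i)" if "1 \<le> j" "j \<le> k" for j
    using that
  proof (induction j rule: dec_induct)
    case base
    show ?case using b_1 by simp
  next
    case (step j)
    then show ?case using bound[of j] b_pos[of "Suc j"] by simp
  qed
  then show ?thesis using assms k_ge_2 by (simp add: greedy_presentation_def)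
qed

section \<open>Membership in the semigroup and its quotient\<close>

lemma generator_eq:
  "1 \<le> i \<Longrightarrow> i \<le> k \<Longrightarrow>
    int (h i) * int a + d * int (b i) = (int u * int a + d) * int (b i) + int a"
  by (simp add: h_eq algebra_simps)

text \<open>The semigroup is defined by sums over a set of generators; injectivity lets the
  coefficients be indexed by \<open>i\<close> instead.\<close>

lemma inj_on_generators:
  assumes "int u * int a + d > 0"
  shows "inj_on (\<lambda>i. int (h i) * int a + d * int (b i)) {1..k}"
proof (rule inj_onI)
  fix i j
  assume ij: "i \<in> {1..k}" "j \<in> {1..k}"
    "int (h i) * int a + d * int (b i) = int (h j) * int a + d * int (b j)"
  then have "b i = b j" using assms by (simp add: generator_eq)
  then show "i = j" using b_less[of i j] b_less[of j i] ij by (cases i j rule: linorder_cases) auto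
qed

lemma generator_neq_a:
  assumes "int u * int a + d > 0" "i \<in> {1..k}"
  shows "int (h i) * int a + d * int (b i) \<noteq> int a"
  using assms b_pos[of i] by (simp add: generator_eq)

lemma sum_gcns_generators:
  assumes w: "int u * int a + d > 0"
  shows "(\<Sum>g\<in>gcns_generators a k d b h. int (c g) * g)
    = (int u * int a + d) * int (\<Sum>i=1..k. b i * c (int (h i) * int a + d * int (b i)))
      + int (c (int a) + (\<Sum>i=1..k. c (int (h i) * int a + d * int (b i)))) * int a"
proof -
  define v where "v = int u * int a + d"
  define f where "f = (\<lambda>i. int (h i) * int a + d * int (b i))"
  have f: "f i = v * int (b i) + int a" if "i \<in> {1..k}" for i
    using that generator_eq by (simp add: f_def v_def)
  have inj: "inj_on f {1..k}" unfolding f_def using w by (rule inj_on_generators)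
  have notin: "int a \<notin> f ` {1..k}"
    unfolding f_def using generator_neq_a[OF w] by (metis (no_types, lifting) imageE)
  have "(\<Sum>g\<in>gcns_generators a k d b h. int (c g) * g)
      = int (c (int a)) * int a + (\<Sum>g\<in>f ` {1..k}. int (c g) * g)"
    using notin by (simp add: gcns_generators_def f_def)
  also have "(\<Sum>g\<in>f ` {1..k}. int (c g) * g) = (\<Sum>i=1..k. int (c (f i)) * f i)"
    using sum.reindex[OF inj] by simp
  also have "\<dots> = (\<Sum>i=1..k. v * int (b i * c (f i)) + int (c (f i)) * int a)"
    by (intro sum.cong) (simp_all add: f algebra_simps)
  also have "\<dots> = v * int (\<Sum>i=1..k. b i * c (f i)) + int (\<Sum>i=1..k. c (f i)) * int a"
    by (simp add: sum.distrib sum_distrib_left sum_distrib_right)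
  finally show ?thesis by (simp add: f_def v_def algebra_simps)
qed

lemma mem_generated_semigroup_iff:
  assumes w: "int u * int a + d > 0"
  shows "z \<in> generated_semigroup (gcns_generators a k d b h) \<longleftrightarrow>
    (\<exists>M n. z = (int u * int a + d) * int M + int n * int a \<and> greedy_count b k M \<le> n)"
proof
  assume "z \<in> generated_semigroup (gcns_generators a k d b h)"
  then obtain c :: "int \<Rightarrow> nat" where z: "z = (\<Sum>g\<in>gcns_generators a k d b h. int (c g) * g)"
    by (auto simp: generated_semigroup_def)
  define y where "y = (\<lambda>i. c (int (h i) * int a + d * int (b i)))"
  have "z = (int u * int a + d) * int (\<Sum>i=1..k. b i * y i)
      + int (c (int a) + (\<Sum>i=1..k. y i)) * int a"
    unfolding z sum_gcns_generators[OF w] y_def ..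
  moreover have "greedy_count b k (\<Sum>i=1..k. b i * y i) \<le> c (int a) + (\<Sum>i=1..k. y i)"
    using greedy_count_optimal[of y] by simp
  ultimately show "\<exists>M n. z = (int u * int a + d) * int M + int n * int a \<and> greedy_count b k M \<le> n"
    by blast
next
  assume "\<exists>M n. z = (int u * int a + d) * int M + int n * int a \<and> greedy_count b k M \<le> n"
  then obtain M n where z: "z = (int u * int a + d) * int M + int n * int a"
    and n: "greedy_count b k M \<le> n" by blast
  obtain y where y: "(\<Sum>i=1..k. b i * y i) = M" "(\<Sum>i=1..k. y i) = greedy_count b k M"
    using greedy_count_attained[of b k M] b_1 k_ge_2 by auto
  define f where "f = (\<lambda>i. int (h i) * int a + d * int (b i))"
  have inj: "inj_on f {1..k}" unfolding f_def using w by (rule inj_on_generators)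
  have ne: "f i \<noteq> int a" if "i \<in> {1..k}" for i
    unfolding f_def using w that by (rule generator_neq_a)
  \<comment> \<open>The generator \<open>a\<close> takes the surplus of \<open>n\<close> over the
    greedy count, since each other summand already contributes one \<open>a\<close>.\<close>
  define c where "c = (\<lambda>g. if g = int a then n - greedy_count b k M else y (the_inv_into {1..k} f g))"
  have c: "c (f i) = y i" if "i \<in> {1..k}" for i
    using ne[OF that] the_inv_into_f_f[OF inj that] by (simp add: c_def)
  have sums: "(\<Sum>i=1..k. b i * c (f i)) = M" "(\<Sum>i=1..k. c (f i)) = greedy_count b k M"
    using y by (simp_all add: c)
  have "(\<Sum>g\<in>gcns_generators a k d b h. int (c g) * g)
      = (int u * int a + d) * int (\<Sum>i=1..k. b i * c (f i))
        + int (c (int a) + (\<Sum>i=1..k. c (f i))) * int a"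
    unfolding f_def by (rule sum_gcns_generators[OF w])
  then have "(\<Sum>g\<in>gcns_generators a k d b h. int (c g) * g) = z"
    unfolding sums z using n by (simp add: c_def)
  then show "z \<in> generated_semigroup (gcns_generators a k d b h)"
    unfolding generated_semigroup_def by blast
qed

lemma mem_semigroup_quotient_iff:
  assumes w: "int u * int a + d > 0" and p: "p > 0" "a = p * q"
  shows "x \<in> semigroup_quotient (generated_semigroup (gcns_generators a k d b h)) p \<longleftrightarrow>
    (\<exists>m n. int x = (int u * int a + d) * int m + int n * int q \<and> greedy_count b k (p * m) \<le> n)"
    (is "?L \<longleftrightarrow> ?R")
proof
  assume ?L
  then obtain M n where M: "int p * int x = (int u * int a + d) * int M + int n * int a"
    "greedy_count b k M \<le> n"
    by (auto simp: semigroup_quotient_def mem_generated_semigroup_iff[OF w])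
  \<comment> \<open>As \<open>p\<close> divides \<open>a\<close>, the factor
    \<open>u * a + d\<close> is congruent to \<open>d\<close> modulo \<open>p\<close>, and
    \<open>d\<close> is coprime to \<open>p\<close>; hence \<open>p\<close> divides
    \<open>M\<close>.\<close>
  have "int p dvd (int u * int a + d) * int M"
  proof -
    have "(int u * int a + d) * int M = int p * (int x - int n * int q)"
      using M(1) p by (simp add: algebra_simps)
    then show ?thesis by simp
  qed
  then have "int p dvd d * int M"
    using p by (simp add: distrib_right dvd_add_right_iff)
  moreover have "coprime (int p) d"
    using coprime_a_d p by (metis coprime_iff_gcd_eq_1 coprime_mult_left_iff of_nat_mult)
  ultimately have "p dvd M" by (simp add: coprime_dvd_mult_right_iff)
  then obtain m where m: "M = p * m" by blast
  have "int p * int x = int p * ((int u * int a + d) * int m + int n * int q)"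
    using M(1) p m by (simp add: algebra_simps)
  then have "int x = (int u * int a + d) * int m + int n * int q"
    using p(1) by simp
  then show ?R using M(2) m by blast
next
  assume ?R
  then obtain m n where m: "int x = (int u * int a + d) * int m + int n * int q"
    "greedy_count b k (p * m) \<le> n" by blast
  have "int p * int x = (int u * int a + d) * int (p * m) + int n * int a"
    unfolding m(1) using p by (simp add: algebra_simps)
  then show ?L using m(2)
    unfolding semigroup_quotient_def mem_generated_semigroup_iff[OF w] by blast
qed

section \<open>The Frobenius number of the quotient\<close>

text \<open>The numbers \<open>w' * r + q * g r\<close> with \<open>r < q\<close> form the Apery set
  of the quotient with respect to \<open>q\<close>. Both bounds on the \<open>s i\<close> enter only
  through \<open>step\<close>, which makes these numbers nondecreasing in \<open>r\<close>.\<close>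

lemma frobenius_number_semigroup_quotient:
  assumes w: "int u * int a + d > 0" and p: "p > 0" "a = p * q"
    and sum_s: "(\<Sum>i=1..k - 1. int (s i)) \<le> int u * int a + d + int k - 2"
    and step: "\<And>M. int q * int (greedy_count b k M)
      \<le> int q * int (greedy_count b k (M + p)) + (int u * int a + d)"
  shows "frobenius_number (semigroup_quotient (generated_semigroup (gcns_generators a k d b h)) p)
    = (int u * int a + d) * (int q - 1) + int q * (int (greedy_count b k (p * (q - 1))) - 1)"
    (is "frobenius_number ?S = ?F")
proof -
  define w' where "w' = int u * int a + d"
  define g where "g = (\<lambda>m. int (greedy_count b k (p * m)))"
  have w': "w' > 0" using w by (simp add: w'_def)
  have q: "q > 0" using p a_ge_2 by (cases q) auto
  have mem: "x \<in> ?S \<longleftrightarrow> (\<exists>m n. int x = w' * int m + int n * int q \<and> g m \<le> int n)" for x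
    using mem_semigroup_quotient_iff[OF w p] by (simp add: w'_def g_def)
  have "coprime (int q) d"
    using coprime_a_d p by (metis coprime_iff_gcd_eq_1 coprime_mult_left_iff of_nat_mult)
  then have cop: "coprime w' (int q)"
    using p by (simp add: w'_def coprime_iff_gcd_eq_1 gcd.commute mult.assoc[symmetric]
        gcd_add_mult)
  have later: "g m \<le> g m' + w'" if "m \<le> m'" for m m'
  proof -
    have "greedy_count b k (p * m) + (k - 2) \<le> greedy_count b k (p * m') + (\<Sum>i=1..k - 1. s i)"
      using that by (intro greedy_count_le_later) simp
    then have "int (greedy_count b k (p * m) + (k - 2))
        \<le> int (greedy_count b k (p * m') + (\<Sum>i=1..k - 1. s i))" by linarith
    then show ?thesis using sum_s k_ge_2 by (simp add: g_def w'_def of_nat_diff)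
  qed
  have increasing: "w' * int r + int q * g r \<le> w' * int (r + e) + int q * g (r + e)" for r e
  proof (induction e)
    case (Suc e)
    have "int q * g (r + e) \<le> int q * g (r + Suc e) + w'"
      using step[of "p * (r + e)"] by (simp add: g_def w'_def algebra_simps)
    then show ?case using Suc by (simp add: algebra_simps)
  qed simp
  have F: "?F = w' * (int q - 1) + int q * (g (q - 1) - 1)"
    by (simp add: w'_def g_def)
  show ?thesis unfolding frobenius_number_def
  proof (rule Greatest_equality)
    show "?F \<notin> int ` ?S"
    proof
      assume "?F \<in> int ` ?S"
      then obtain m n where mn: "?F = w' * int m + int n * int q" "g m \<le> int n"
        using mem by auto
      have eq: "w' * (int m - (int q - 1)) = int q * (g (q - 1) - 1 - int n)"
        using mn(1) unfolding F by (simp add: algebra_simps)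
      then have "int q dvd w' * (int m - (int q - 1))" by simp
      then have "int q dvd int m - (int q - 1)"
        using cop by (simp add: coprime_commute coprime_dvd_mult_right_iff)
      then obtain t where t: "int m - (int q - 1) = int q * t" by blast
      \<comment> \<open>Since \<open>m \<ge> 0\<close>, the difference is at least
        \<open>-(q - 1)\<close>, which excludes negative \<open>t\<close>.\<close>
      have "int q * t > int q * (-1)" using t by simp
      then have t0: "t \<ge> 0" using q by (simp only: mult_less_cancel_left) simp
      have "int q * (w' * t) = int q * (g (q - 1) - 1 - int n)"
        using eq unfolding t by (simp add: algebra_simps)
      then have n: "w' * t = g (q - 1) - 1 - int n" using q by simp
      show False
      proof (cases "t = 0")
        case True
        then have "m = q - 1" using t q by simp
        then show False using n True mn(2) by simp
      next
        case False
        \<comment> \<open>Moving \<open>m\<close> up by \<open>q * t\<close> costs at least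
          \<open>w'\<close> in \<open>n\<close>, whereas \<open>g\<close> can fall by at most
          \<open>w'\<close>; the missing 1 gives the contradiction.\<close>
        then have "w' * 1 \<le> w' * t" using t0 w' by (intro mult_left_mono) auto
        moreover have "int m \<ge> int q - 1"
          using t t0 by (metis diff_ge_0_iff_ge mult_nonneg_nonneg of_nat_0_le_iff)
        then have "g (q - 1) \<le> g m + w'" using q by (intro later) linarith
        ultimately show False using n mn(2) by linarith
      qed
    qed
  next
    fix z assume z: "z \<notin> int ` ?S"
    show "z \<le> ?F"
    proof (rule ccontr)
      assume "\<not> z \<le> ?F"
      then have zF: "z > w' * (int q - 1) + int q * (g (q - 1) - 1)" unfolding F by simp
      \<comment> \<open>Multiplying by an inverse of \<open>w'\<close> modulo \<open>q\<close> picks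
        the \<open>r < q\<close> with \<open>w' * r\<close> congruent to \<open>z\<close>.\<close>
      obtain v where v: "[w' * v = 1] (mod int q)" using cop cong_solve_coprime_int by blast
      define r where "r = nat ((v * z) mod int q)"
      have r: "int r = (v * z) mod int q" using q by (simp add: r_def)
      have rq: "r < q" using q r by (metis of_nat_0_less_iff of_nat_less_iff pos_mod_bound)
      have "[w' * int r = w' * (v * z)] (mod int q)"
        unfolding r by (intro cong_mult) (auto simp: cong_def)
      also have "[w' * (v * z) = 1 * z] (mod int q)"
        unfolding mult.assoc[symmetric] using v by (intro cong_mult) auto
      finally obtain n where n: "z = w' * int r + n * int q"
        by (metis cong_iff_lin cong_sym mult.commute mult_1)
      have "w' * int r + int q * g r \<le> w' * (int q - 1) + int q * g (q - 1)"
        using increasing[of r "q - 1 - r"] rq by (simp add: of_nat_diff)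
      then have "int q * (g r - 1) < int q * n" using zF n by (simp add: algebra_simps)
      then have gn: "g r \<le> n" using q by (simp only: mult_less_cancel_left) simp
      moreover have "g r \<ge> 0" by (simp add: g_def)
      ultimately have n0: "n \<ge> 0" by simp
      then have "z \<ge> 0" using n w' by simp
      then have "nat z \<in> ?S" unfolding mem using n n0 gn
        by (intro exI[of _ r] exI[of _ "nat n"]) simp
      then show False using z \<open>z \<ge> 0\<close> by (metis image_eqI nat_0_le)
    qed
  qed
qed

end

theorem theorem3p2:
  fixes a k u p :: nat and d :: int and s b h x :: "nat \<Rightarrow> nat"
  assumes "gcns a k u d s b h"
    and "p > 0" and "p dvd a" and "p \<noteq> a"
    and "greedy_presentation k s b (a - p) x"
  defines "F \<equiv> frobenius_number
      (semigroup_quotient (generated_semigroup (gcns_generators a k d b h)) p)"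
    and "R \<equiv> (\<Sum>i=1..k. int (x i)) * int (a div p)
      + (int (a div p) - 1) * (int u * int a + d) - int (a div p)"
  shows "(int u * int a + d + int k - 2 \<ge> (\<Sum>i=1..k - 1. int (s i))
          \<and> int a + int p * d \<ge> 0
          \<and> (\<forall>i\<in>{1..k - 1}. s i < u + 1)
          \<longrightarrow> F = R)
       \<and> (d > 0
          \<and> int u * int a + d + int k - 2 \<ge> (\<Sum>i=1..k - 1. int (s i))
          \<and> (\<forall>i\<in>{1..k - 1}. s i \<le> u + 1)
          \<longrightarrow> F = R)"
proof -
  interpret gcns a k u d s b h by fact
  obtain q where a: "a = p * q" using \<open>p dvd a\<close> by blast
  have q: "a div p = q" using a \<open>p > 0\<close> by simp
  have "a - p = p * (q - 1)" using a by (simp add: algebra_simps)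
  then have "(\<Sum>i=1..k. x i) = greedy_count b k (p * (q - 1))"
    using greedy_presentation_sum assms(5) by simp
  then have sum_x: "(\<Sum>i=1..k. int (x i)) = int (greedy_count b k (p * (q - 1)))"
    by (metis of_nat_sum)
  have main: "F = R"
    if w: "int u * int a + d > 0"
      and sum_s: "(\<Sum>i=1..k - 1. int (s i)) \<le> int u * int a + d + int k - 2"
      and c: "1 \<le> c" "\<And>i. 1 \<le> i \<Longrightarrow> i < k \<Longrightarrow> s i \<le> c"
      \<comment> \<open>Going from \<open>M\<close> to \<open>M + p\<close> takes \<open>p\<close>
        unit steps, each lowering the count by at most \<open>c - 1\<close>; after scaling by
        \<open>q\<close> this loss must not exceed \<open>u * a + d\<close>.\<close>
      and small: "int q * (int p * (int c - 1)) \<le> int u * int a + d" for c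
  proof -
    have "int q * int (greedy_count b k M)
        \<le> int q * int (greedy_count b k (M + p)) + (int u * int a + d)" for M
    proof -
      have "greedy_count b k M + p \<le> greedy_count b k (M + p) + p * c"
        using c k_ge_2 by (intro greedy_count_add_le) auto
      then have "int (greedy_count b k M + p) \<le> int (greedy_count b k (M + p) + p * c)"
        by (simp only: of_nat_le_iff)
      then have "int (greedy_count b k M) \<le> int (greedy_count b k (M + p)) + int p * (int c - 1)"
        by (simp add: algebra_simps)
      then have "int q * int (greedy_count b k M)
          \<le> int q * (int (greedy_count b k (M + p)) + int p * (int c - 1))"
        by (intro mult_left_mono) auto
      then show ?thesis using small by (simp add: distrib_left)
    qed
    from frobenius_number_semigroup_quotient[OF w \<open>p > 0\<close> a sum_s this]
    show ?thesis unfolding F_def R_def q sum_x by (simp only: algebra_simps)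
  qed
  show ?thesis
  proof (intro conjI impI; elim conjE)
    assume sum_s: "(\<Sum>i=1..k - 1. int (s i)) \<le> int u * int a + d + int k - 2"
      and apd: "0 \<le> int a + int p * d" and su: "\<forall>i\<in>{1..k - 1}. s i < u + 1"
    \<comment> \<open>Here \<open>c = u\<close>, so \<open>small\<close> amounts to
      \<open>a + d \<ge> 0\<close>, which follows from \<open>q + d \<ge> 0\<close> and
      \<open>q \<le> a\<close>.\<close>
    have "0 \<le> int p * (int q + d)" using apd a by (simp add: algebra_simps)
    then have dq: "int q + d \<ge> 0" using \<open>p > 0\<close> by (simp add: zero_le_mult_iff)
    have qa: "int q \<le> int p * int q" using \<open>p > 0\<close> by (simp add: mult_le_cancel_right1)
    have small: "int q * (int p * (int u - 1)) \<le> int u * int a + d"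
      using dq qa a by (simp add: algebra_simps)
    have "0 \<le> int q * (int p * (int u - 1))" using u_pos by simp
    then have "int u * int a + d \<ge> 0" using small by linarith
    \<comment> \<open>Otherwise \<open>a\<close> would divide \<open>d\<close>, against coprimality
      and \<open>a \<ge> 2\<close>.\<close>
    moreover have "int u * int a + d \<noteq> 0"
    proof
      assume "int u * int a + d = 0"
      then have "d = int a * (- int u)" by (simp add: algebra_simps)
      then have "int a dvd d" by simp
      then show False using coprime_a_d a_ge_2 by (simp add: gcd_proj1_if_dvd)
    qed
    ultimately show "F = R"
      using main[of u] sum_s small su u_pos by force
  next
    assume sum_s: "(\<Sum>i=1..k - 1. int (s i)) \<le> int u * int a + d + int k - 2"
      and d: "0 < d" and su: "\<forall>i\<in>{1..k - 1}. s i \<le> u + 1"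
    have "0 < int u * int a + d" using d by (simp add: add_nonneg_pos)
    \<comment> \<open>With \<open>c = u + 1\<close> the left side is \<open>u * a\<close>, so
      \<open>d > 0\<close> suffices.\<close>
    moreover have "int q * (int p * (int (u + 1) - 1)) \<le> int u * int a + d"
      using d a by (simp add: algebra_simps)
    ultimately show "F = R" using main[of "u + 1"] sum_s su by force
  qed
qed

end
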